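(* Let $k,l,w\in\mathbb{N}$ be fixed. Then for every integer $n\ge2w$ and every $\mathcal{S}_n$-invariant signomial $f\in C_{\mathrm{SAGE}}(\mathcal{A},\mathcal{B})$ of the form $$f(x)=\sum_{\alpha\in\mathcal{A}}c_\alpha e^{\langle\alpha,x\rangle}+\sum_{\beta\in\mathcal{B}}c_\beta e^{\langle\beta,x\rangle}$$ (with $\mathcal{A}\neq\emptyset$, $\mathcal{B}$ disjoint finite subsets of $\mathbb{R}^n$, $c_\alpha>0$ for $\alpha\in\mathcal{A}$, $c_\beta<0$ for $\beta\in\mathcal{B}$), with sets of orbit representatives $\hat{\mathcal{A}},\hat{\mathcal{B}}$ of $\mathcal{A},\mathcal{B}$ satisfying $|\hat{\mathcal{A}}|\le k$, $|\hat{\mathcal{B}}|\le l$ and $$\max_{\hat\gamma\in\hat{\mathcal{A}}\cup\hat{\mathcal{B}}}\mathrm{wt}(\hat\gamma)\le w,$$ the number of constraints $C_n$ and the number of variables $V_n$ of the symmetry-adapted relative entropy program of $f$ are bounded by constants depending only on $k,l,w$: $$C_n\le k+l+l(w+1)\qquad\text{and}\qquad V_n\le 2lk\,u(w),\qquad\text{where } u(w)=\sum_{i=0}^{w}\binom{w}{i}^2 i!\,.$$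
   Context: $\mathbb{N}=\{0,1,2,\dots\}$. $G=\mathcal{S}_n$ acts on $\mathbb{R}^n$ by $\sigma(x)=(x_{\sigma^{-1}(1)},\dots,x_{\sigma^{-1}(n)})$, both on variables and on exponent vectors. $\mathrm{wt}(\alpha)$ is the number of nonzero coordinates of $\alpha$. $f$ is $\mathcal{S}_n$-invariant if $f(\sigma(x))=f(x)$ for all $\sigma$; then $\mathcal{A}$ and $\mathcal{B}$ are $\mathcal{S}_n$-stable. A set of orbit representatives contains exactly one element of each orbit. $\mathrm{Stab}(\beta)=\{\sigma\in\mathcal{S}_n:\sigma(\beta)=\beta\}$; $\mathcal{S}/H$ is the set of $H$-orbits in $\mathcal{S}$, and sums over $\mathcal{S}/H$ run over one representative per orbit. Cones. For a finite set $\mathcal{A}'$ and $\beta\notin\mathcal{A}'$, $C_{\mathrm{AGE}}(\mathcal{A}',\beta)$ is the set of functions $\sum_{\alpha\in\mathcal{A}'}c_\alpha e^{\langle\alpha,x\rangle}+c_\beta e^{\langle\beta,x\rangle}$ with $c_\alpha\ge0$ $(\alpha\in\mathcal{A}')$, $c_\beta\in\mathbb{R}$, nonnegative on $\mathbb{R}^n$; $C_{\mathrm{SAGE}}(\mathcal{A},\mathcal{B})=\sum_{\beta\in\mathcal{B}}C_{\mathrm{AGE}}((\mathcal{A}\cup\mathcal{B})\setminus\{\beta\},\beta)$ (Minkowski sum). The symmetry-adapted relative entropy program of $f$ has as variables the entries of nonnegative vectors $c^{(\hat\beta)},\nu^{(\hat\beta)}\in\mathbb{R}_+^{\mathcal{A}/\mathrm{Stab}(\hat\beta)}$,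 one pair for each $\hat\beta\in\hat{\mathcal{B}}$, subject to $$\sum_{\alpha\in\mathcal{A}/\mathrm{Stab}(\hat\beta)}\nu^{(\hat\beta)}_\alpha\sum_{\alpha'\in\mathrm{Stab}(\hat\beta)\cdot\alpha}(\alpha'-\hat\beta)=0\quad(\hat\beta\in\hat{\mathcal{B}}),$$ $$\sum_{\alpha\in\mathcal{A}/\mathrm{Stab}(\hat\beta)}|\mathrm{Stab}(\hat\beta)\cdot\alpha|\,\nu^{(\hat\beta)}_\alpha\ln\frac{\nu^{(\hat\beta)}_\alpha}{e\,c^{(\hat\beta)}_\alpha}\le c_{\hat\beta}\quad(\hat\beta\in\hat{\mathcal{B}}),$$ $$\sum_{\hat\beta\in\hat{\mathcal{B}}}\frac{|\mathrm{Stab}(\alpha)|}{|\mathrm{Stab}(\hat\beta)|}\sum_{\gamma\in(G\cdot\alpha)/\mathrm{Stab}(\hat\beta)}|\mathrm{Stab}(\hat\beta)\cdot\gamma|\,c^{(\hat\beta)}_\gamma\le c_\alpha\quad(\alpha\in\hat{\mathcal{A}}).$$ Its number of variables is $V_n=2\sum_{\hat\beta\in\hat{\mathcal{B}}}|\mathcal{A}/\mathrm{Stab}(\hat\beta)|$. The vector equality for $\hat\beta$ is read in the subspace $(\mathbb{R}^n)^{\mathrm{Stab}(\hat\beta)}$ of vectors fixed by $\mathrm{Stab}(\hat\beta)$ (which contains its left-hand side) and counts as $n_{\hat\beta}=\dim(\mathbb{R}^n)^{\mathrm{Stab}(\hat\beta)}$ scalar equalities; nonnegativity of variables is not counted. Hence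 the number of constraints is $C_n=|\hat{\mathcal{A}}|+|\hat{\mathcal{B}}|+\sum_{\hat\beta\in\hat{\mathcal{B}}}n_{\hat\beta}$. *)

theory Defs
  imports "HOL-Analysis.Analysis" "HOL-Algebra.Group_Action"
begin

section \<open>The symmetric group acting on coordinates\<close>

abbreviation sym_grp :: "('n \<Rightarrow> 'n) monoid" where
  "sym_grp \<equiv> BijGroup UNIV"

definition perm_vec :: "('n \<Rightarrow> 'n) \<Rightarrow> real ^ 'n \<Rightarrow> real ^ 'n" where
  "perm_vec \<sigma> x = (\<chi> i. x $ inv_into UNIV \<sigma> i)"

lemma group_action_perm_vec: "group_action (sym_grp :: ('n::finite \<Rightarrow> 'n) monoid) UNIV perm_vec"
proof -
  have comp: "perm_vec (\<sigma> \<circ> \<tau>) = perm_vec \<sigma> \<circ> perm_vec \<tau>" if "bij \<sigma>" "bij \<tau>" for \<sigma> \<tau> :: "'n \<Rightarrow> 'n"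
    by (rule ext) (simp add: perm_vec_def vec_eq_iff o_inv_distrib[OF that])
  have perm_id: "perm_vec id = (id :: real ^ 'n \<Rightarrow> _)"
    by (rule ext) (simp add: perm_vec_def vec_eq_iff)
  have bij_perm: "bij (perm_vec \<sigma>)" if "bij \<sigma>" for \<sigma> :: "'n \<Rightarrow> 'n"
  proof (rule o_bij)
    have s: "surj \<sigma>" and i: "inj \<sigma>"
      using that by (simp_all add: bij_is_surj bij_is_inj)
    show "perm_vec (inv_into UNIV \<sigma>) \<circ> perm_vec \<sigma> = id"
      unfolding comp[OF bij_imp_bij_inv[OF that] that, symmetric] inj_iff[THEN iffD1, OF i] perm_id ..
    show "perm_vec \<sigma> \<circ> perm_vec (inv_into UNIV \<sigma>) = id"
      unfolding comp[OF that bij_imp_bij_inv[OF that], symmetric] surj_iff[THEN iffD1, OF s] perm_id ..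
  qed
  have "perm_vec \<in> hom (sym_grp :: ('n \<Rightarrow> 'n) monoid) (BijGroup UNIV)"
    using bij_perm comp
    by (simp add: hom_def BijGroup_def Bij_def compose_def o_def restrict_UNIV)
  then show ?thesis
    by (simp add: group_action_def group_hom_def group_hom_axioms_def group_BijGroup)
qed

abbreviation sym_orbit :: "real ^ 'n \<Rightarrow> (real ^ 'n) set" where
  "sym_orbit \<equiv> orbit sym_grp perm_vec"

abbreviation Stab :: "real ^ 'n \<Rightarrow> ('n \<Rightarrow> 'n) set" where
  "Stab \<equiv> stabilizer sym_grp perm_vec"

abbreviation stab_grp :: "real ^ 'n \<Rightarrow> ('n \<Rightarrow> 'n) monoid" where
  "stab_grp \<beta> \<equiv> sym_grp\<lparr>carrier := Stab \<beta>\<rparr>"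

text \<open>The set of Stab-orbits in a set; a sum over it needs no choice of representatives, because an
  orbit of the stabilizer is itself the set written Stab times representative.\<close>

abbreviation stab_orbits :: "(real ^ 'n) set \<Rightarrow> real ^ 'n \<Rightarrow> (real ^ 'n) set set" where
  "stab_orbits S \<beta> \<equiv> orbits (stab_grp \<beta>) S perm_vec"

definition stab_fixed :: "real ^ 'n \<Rightarrow> (real ^ 'n) set" where
  "stab_fixed \<beta> = {v. \<forall>\<sigma>\<in>Stab \<beta>. perm_vec \<sigma> v = v}"

definition orbit_reps :: "(real ^ 'n) set \<Rightarrow> (real ^ 'n) set \<Rightarrow> bool" where
  "orbit_reps R S \<longleftrightarrow> R \<subseteq> S \<and> (\<forall>\<omega>\<in>orbits sym_grp S perm_vec. \<exists>!r. r \<in> R \<and> r \<in> \<omega>)"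

definition sym_invariant :: "(real ^ 'n \<Rightarrow> real) \<Rightarrow> bool" where
  "sym_invariant f \<longleftrightarrow> (\<forall>\<sigma>\<in>carrier sym_grp. \<forall>x. f (perm_vec \<sigma> x) = f x)"

definition wt :: "real ^ 'n \<Rightarrow> nat" where
  "wt \<alpha> = card {i. \<alpha> $ i \<noteq> 0}"

section \<open>AGE and SAGE cones\<close>

definition C_AGE :: "(real ^ 'n) set \<Rightarrow> real ^ 'n \<Rightarrow> (real ^ 'n \<Rightarrow> real) set" where
  "C_AGE A' \<beta> = {f. \<exists>c. (\<forall>\<alpha>\<in>A'. 0 \<le> c \<alpha>) \<and>
     f = (\<lambda>x. (\<Sum>\<alpha>\<in>A'. c \<alpha> * exp (\<alpha> \<bullet> x)) + c \<beta> * exp (\<beta> \<bullet> x)) \<and> (\<forall>x. 0 \<le> f x)}"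

definition C_SAGE :: "(real ^ 'n) set \<Rightarrow> (real ^ 'n) set \<Rightarrow> (real ^ 'n \<Rightarrow> real) set" where
  "C_SAGE A B = {f. \<exists>g. (\<forall>\<beta>\<in>B. g \<beta> \<in> C_AGE ((A \<union> B) - {\<beta>}) \<beta>) \<and> f = (\<lambda>x. \<Sum>\<beta>\<in>B. g \<beta> x)}"

section \<open>Programs in nonnegative variables and their size\<close>

text \<open>\<open>Vec_Eq U g\<close> is the equation \<open>g x = 0\<close> read in the subspace \<open>U\<close>, which contains the values of
  \<open>g\<close>; it counts as \<open>dim U\<close> scalar equalities. Left-hand sides of inequalities are extended reals
  since relative entropy terms can be infinite.\<close>

datatype ('x, 'v) constr =
    Vec_Eq "'v set" "('x \<Rightarrow> real) \<Rightarrow> 'v"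
  | Ineq_Le "('x \<Rightarrow> real) \<Rightarrow> ereal" real

fun holds_constr :: "('x \<Rightarrow> real) \<Rightarrow> ('x, 'v::real_vector) constr \<Rightarrow> bool" where
  "holds_constr x (Vec_Eq U g) \<longleftrightarrow> g x = 0"
| "holds_constr x (Ineq_Le h b) \<longleftrightarrow> h x \<le> ereal b"

fun scalar_count :: "('x, 'v::real_vector) constr \<Rightarrow> nat" where
  "scalar_count (Vec_Eq U g) = dim U"
| "scalar_count (Ineq_Le h b) = 1"

record ('x, 'l, 'v) program =
  prog_vars :: "'x set"
  prog_labels :: "'l set"
  prog_constr :: "'l \<Rightarrow> ('x, 'v) constr"

definition feasible :: "('x, 'l, 'v::real_vector) program \<Rightarrow> ('x \<Rightarrow> real) \<Rightarrow> bool" where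
  "feasible P x \<longleftrightarrow> (\<forall>v\<in>prog_vars P. 0 \<le> x v) \<and> (\<forall>l\<in>prog_labels P. holds_constr x (prog_constr P l))"

definition num_variables :: "('x, 'l, 'v) program \<Rightarrow> nat" where
  "num_variables P = card (prog_vars P)"

definition num_constraints :: "('x, 'l, 'v::real_vector) program \<Rightarrow> nat" where
  "num_constraints P = (\<Sum>l\<in>prog_labels P. scalar_count (prog_constr P l))"

section \<open>The symmetry-adapted relative entropy program\<close>

text \<open>\<open>C_var \<beta> \<omega>\<close> and \<open>Nu_var \<beta> \<omega>\<close> are the entries of the vectors for the representative \<open>\<beta>\<close> at the
  \<open>Stab \<beta>\<close>-orbit \<open>\<omega>\<close>.\<close>

datatype 'v svar = C_var 'v "'v set" | Nu_var 'v "'v set"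

datatype 'v slabel = Balance 'v | Entropy 'v | Coefficient 'v

text \<open>The term \<open>\<nu> ln (\<nu> / (e c))\<close> with the usual conventions \<open>0 ln (0 / c) = 0\<close> (also for \<open>c = 0\<close>)
  and \<open>\<nu> ln (\<nu> / 0) = \<infinity>\<close> for \<open>\<nu> > 0\<close>; with HOL's \<open>ln 0 = 0\<close> and division by zero the bare formula
  would be wrong at \<open>c = 0\<close>.\<close>

definition rel_entr :: "real \<Rightarrow> real \<Rightarrow> ereal" where
  "rel_entr \<nu> c = (if \<nu> = 0 then 0 else if c = 0 then \<infinity> else ereal (\<nu> * ln (\<nu> / (exp 1 * c))))"

fun sym_constr :: "(real ^ 'n) set \<Rightarrow> (real ^ 'n) set \<Rightarrow> (real ^ 'n \<Rightarrow> real) \<Rightarrow>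
    (real ^ 'n) slabel \<Rightarrow> ((real ^ 'n) svar, real ^ 'n) constr" where
  "sym_constr A Bhat c (Balance \<beta>) =
     Vec_Eq (stab_fixed \<beta>)
       (\<lambda>x. \<Sum>\<omega>\<in>stab_orbits A \<beta>. x (Nu_var \<beta> \<omega>) *\<^sub>R (\<Sum>\<alpha>'\<in>\<omega>. \<alpha>' - \<beta>))"
| "sym_constr A Bhat c (Entropy \<beta>) =
     Ineq_Le
       (\<lambda>x. \<Sum>\<omega>\<in>stab_orbits A \<beta>.
          ereal (real (card \<omega>)) * rel_entr (x (Nu_var \<beta> \<omega>)) (x (C_var \<beta> \<omega>)))
       (c \<beta>)"
| "sym_constr A Bhat c (Coefficient \<alpha>) =
     Ineq_Le
       (\<lambda>x. ereal (\<Sum>\<beta>\<in>Bhat. real (card (Stab \<alpha>)) / real (card (Stab \<beta>)) *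
          (\<Sum>\<omega>\<in>stab_orbits (sym_orbit \<alpha>) \<beta>. real (card \<omega>) * x (C_var \<beta> \<omega>))))
       (c \<alpha>)"

definition sym_program :: "(real ^ 'n) set \<Rightarrow> (real ^ 'n) set \<Rightarrow> (real ^ 'n) set \<Rightarrow>
    (real ^ 'n \<Rightarrow> real) \<Rightarrow> ((real ^ 'n) svar, (real ^ 'n) slabel, real ^ 'n) program" where
  "sym_program A Ahat Bhat c =
     \<lparr>prog_vars = (\<Union>\<beta>\<in>Bhat. C_var \<beta> ` stab_orbits A \<beta> \<union> Nu_var \<beta> ` stab_orbits A \<beta>),
      prog_labels = Balance ` Bhat \<union> Entropy ` Bhat \<union> Coefficient ` Ahat,
      prog_constr = sym_constr A Bhat c\<rparr>"

lemma balance_lhs_stab_fixed: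
  fixes A :: "(real ^ 'n::finite) set"
  shows "(\<Sum>\<omega>\<in>stab_orbits A \<beta>. y \<omega> *\<^sub>R (\<Sum>\<alpha>'\<in>\<omega>. \<alpha>' - \<beta>)) \<in> stab_fixed \<beta>"
  unfolding stab_fixed_def
proof (intro CollectI ballI)
  fix \<sigma> assume \<sigma>: "\<sigma> \<in> Stab \<beta>"
  interpret group_action "sym_grp :: ('n \<Rightarrow> 'n) monoid" UNIV perm_vec
    by (rule group_action_perm_vec)
  have \<sigma>c: "\<sigma> \<in> carrier sym_grp" and fix\<beta>: "perm_vec \<sigma> \<beta> = \<beta>"
    using \<sigma> by (auto simp: stabilizer_def)
  have lin: "linear (perm_vec \<sigma>)"
    by (rule linearI) (simp_all add: perm_vec_def vec_eq_iff)
  have inj: "inj (perm_vec \<sigma>)"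
    by (rule inj_prop[OF \<sigma>c])
  have "finite (carrier (sym_grp :: ('n \<Rightarrow> 'n) monoid))"
    by simp
  then have finS: "finite (Stab \<beta>)"
    by (rule finite_subset[OF stabilizer_subset])
  have img: "perm_vec \<sigma> ` \<omega> = \<omega>" if \<omega>A: "\<omega> \<in> stab_orbits A \<beta>" for \<omega>
  proof -
    obtain a where \<omega>: "\<omega> = (\<lambda>\<tau>. perm_vec \<tau> a) ` Stab \<beta>"
      using \<omega>A by (auto simp: orbits_def orbit_def Setcompr_eq_image)
    have "perm_vec \<sigma> (perm_vec \<tau> a) \<in> \<omega>" if \<tau>: "\<tau> \<in> Stab \<beta>" for \<tau>
    proof -
      have "perm_vec \<sigma> (perm_vec \<tau> a) = perm_vec (\<sigma> \<otimes>\<^bsub>sym_grp\<^esub> \<tau>) a"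
        using composition_rule[of a \<sigma> \<tau>] \<sigma>c \<tau> by (auto simp: stabilizer_def)
      then show ?thesis
        unfolding \<omega> using stabilizer_m_closed[OF UNIV_I \<sigma> \<tau>] by blast
    qed
    then have "perm_vec \<sigma> ` \<omega> \<subseteq> \<omega>"
      by (auto simp: \<omega>)
    moreover have "finite \<omega>"
      using finS by (simp add: \<omega>)
    ultimately show ?thesis
      by (intro card_subset_eq) (auto intro!: card_image inj_on_subset[OF inj])
  qed
  have "perm_vec \<sigma> (\<Sum>\<alpha>'\<in>\<omega>. \<alpha>' - \<beta>) = (\<Sum>\<alpha>'\<in>\<omega>. \<alpha>' - \<beta>)" if \<omega>: "\<omega> \<in> stab_orbits A \<beta>" for \<omega>
  proof -
    have "perm_vec \<sigma> (\<Sum>\<alpha>'\<in>\<omega>. \<alpha>' - \<beta>) = (\<Sum>\<alpha>'\<in>\<omega>. perm_vec \<sigma> \<alpha>' - \<beta>)"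
      by (simp add: linear_sum[OF lin] linear_diff[OF lin] fix\<beta>)
    also have "\<dots> = (\<Sum>\<alpha>'\<in>perm_vec \<sigma> ` \<omega>. \<alpha>' - \<beta>)"
      by (simp add: sum.reindex[OF inj_on_subset[OF inj]])
    finally show ?thesis
      by (simp add: img[OF \<omega>])
  qed
  then show "perm_vec \<sigma> (\<Sum>\<omega>\<in>stab_orbits A \<beta>. y \<omega> *\<^sub>R (\<Sum>\<alpha>'\<in>\<omega>. \<alpha>' - \<beta>)) =
      (\<Sum>\<omega>\<in>stab_orbits A \<beta>. y \<omega> *\<^sub>R (\<Sum>\<alpha>'\<in>\<omega>. \<alpha>' - \<beta>))"
    by (simp only: linear_sum[OF lin] linear_scale[OF lin] cong: sum.cong)
qed

lemma num_variables_sym_program: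
  fixes A :: "(real ^ 'n::finite) set"
  assumes "finite A" "finite Bhat"
  shows "num_variables (sym_program A Ahat Bhat c) = 2 * (\<Sum>\<beta>\<in>Bhat. card (stab_orbits A \<beta>))"
proof -
  have fin: "finite (stab_orbits A \<beta>)" for \<beta>
    using assms(1) by (simp add: orbits_def setcompr_eq_image)
  have "card (C_var \<beta> ` stab_orbits A \<beta> \<union> Nu_var \<beta> ` stab_orbits A \<beta>) = 2 * card (stab_orbits A \<beta>)" for \<beta>
    by (subst card_Un_disjoint) (auto simp: fin card_image inj_on_def)
  then show ?thesis
    unfolding num_variables_def sym_program_def
    by (simp add: sum_distrib_left)
       (subst card_UN_disjoint, auto simp: fin assms)
qed

lemma num_constraints_sym_program:
  fixes Ahat Bhat :: "(real ^ 'n::finite) set"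
  assumes "finite Ahat" "finite Bhat"
  shows "num_constraints (sym_program A Ahat Bhat c) =
    card Ahat + card Bhat + (\<Sum>\<beta>\<in>Bhat. dim (stab_fixed \<beta>))"
proof -
  have "sum h (Balance ` Bhat \<union> Entropy ` Bhat \<union> Coefficient ` Ahat) =
    sum h (Balance ` Bhat) + sum h (Entropy ` Bhat) + sum h (Coefficient ` Ahat)"
    for h :: "(real ^ 'n) slabel \<Rightarrow> nat"
    using assms by (subst sum.union_disjoint; auto)+
  then show ?thesis
    by (simp add: num_constraints_def sym_program_def sum.reindex inj_on_def)
qed

definition u_bound :: "nat \<Rightarrow> nat" where
  "u_bound w = (\<Sum>i=0..w. (w choose i)\<^sup>2 * fact i)"

end

theory Submission
  imports Defs
begin

text \<open>An element of the orbit of \<open>\<alpha>\<close> has the form \<open>\<alpha> \<circ> \<tau>\<close> for a permutation \<open>\<tau>\<close>. Since \<open>Stab \<beta>\<close> contains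
  all permutations that fix the support of \<open>\<beta>\<close> pointwise, and \<open>\<alpha> \<circ> \<tau>\<close> always has the same multiset of
  entries, the \<open>Stab \<beta>\<close>-orbit of \<open>\<alpha> \<circ> \<tau>\<close> depends only on the restriction of \<open>\<alpha> \<circ> \<tau>\<close> to the support of
  \<open>\<beta>\<close>. That restriction is determined by the partial injection which \<open>\<tau>\<close> induces from the support of
  \<open>\<beta>\<close> to the support of \<open>\<alpha>\<close>, and \<open>u_bound w\<close> counts the partial injections between two
  \<open>w\<close>-element sets. A vector fixed by \<open>Stab \<beta>\<close> is constant on the level sets of \<open>\<beta>\<close>, of which there
  are at most \<open>w + 1\<close>.\<close>

section \<open>Counting partial injections\<close>

text \<open>Subsets are grouped by size; this turns a sum over the possible domains of partial
  injections into a sum over their cardinalities.\<close>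

lemma sum_Pow_card:
  fixes g :: "nat \<Rightarrow> 'b::comm_semiring_1"
  assumes "finite X"
  shows "(\<Sum>D\<in>Pow X. g (card D)) = (\<Sum>i=0..card X. of_nat (card X choose i) * g i)"
proof -
  have "(\<Sum>D\<in>Pow X. g (card D)) = (\<Sum>i=0..card X. \<Sum>D\<in>{D\<in>Pow X. card D = i}. g (card D))"
    using assms by (intro sum.group[symmetric]) (auto intro: card_mono)
  also have "\<dots> = (\<Sum>i=0..card X. \<Sum>D\<in>{D\<in>Pow X. card D = i}. g i)"
    by (intro sum.cong) auto
  also have "\<dots> = (\<Sum>i=0..card X. of_nat (card X choose i) * g i)"
    by (simp add: n_subsets[OF assms])
  finally show ?thesis .
qed

text \<open>Rewrites the falling factorial that counts injections. Truncated subtraction is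
  harmless: for \<open>k > n\<close> the factor at \<open>i = n\<close> is 0, and so is the binomial
  coefficient.\<close>

lemma prod_diff_eq_fact_binomial:
  "(\<Prod>i=0..<k. n - i) = fact k * (n choose k)" for n k :: nat
proof (induction k)
  case (Suc k)
  have "(n choose k) * (n - k) = Suc k * (n choose Suc k)"
    by (metis binomial_absorb_comp binomial_absorption mult.commute)
  then show ?case
    by (simp add: Suc algebra_simps)
qed simp

lemma card_injections:
  assumes "finite D" "finite Y"
  shows "card {g \<in> D \<rightarrow>\<^sub>E Y. inj_on g D} = fact (card D) * (card Y choose card D)"
  using card_inj_on_subset_funcset[OF assms subset_refl]
  by (simp add: prod_diff_eq_fact_binomial)

text \<open>The domain is stored explicitly, and the extensional function space fixes the values
  outside it, so each partial injection occurs exactly once.\<close>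

definition partial_injections :: "'a set \<Rightarrow> 'b set \<Rightarrow> ('a set \<times> ('a \<Rightarrow> 'b)) set" where
  "partial_injections X Y = (SIGMA D:Pow X. {g \<in> D \<rightarrow>\<^sub>E Y. inj_on g D})"

lemma finite_partial_injections:
  assumes "finite X" "finite Y"
  shows "finite (partial_injections X Y)"
  unfolding partial_injections_def
  using assms by (intro finite_SigmaI) (auto intro: finite_PiE finite_subset)

lemma card_partial_injections:
  assumes "finite X" "finite Y"
  shows "card (partial_injections X Y)
    = (\<Sum>i=0..card X. (card X choose i) * (card Y choose i) * fact i)"
proof -
  have "card (partial_injections X Y) = (\<Sum>D\<in>Pow X. card {g \<in> D \<rightarrow>\<^sub>E Y. inj_on g D})"
    unfolding partial_injections_def
    using assms by (intro card_SigmaI) (auto intro!: finite_PiE intro: finite_subset)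
  also have "\<dots> = (\<Sum>D\<in>Pow X. fact (card D) * (card Y choose card D))"
    using assms by (intro sum.cong refl card_injections) (auto intro: finite_subset)
  also have "\<dots> = (\<Sum>i=0..card X. (card X choose i) * (card Y choose i) * fact i)"
    by (simp add: sum_Pow_card[OF assms(1), of "\<lambda>i. fact i * (card Y choose i)"] ac_simps)
  finally show ?thesis .
qed

text \<open>Each binomial coefficient grows with its upper argument, and raising the summation limit
  to \<open>w\<close> only adds nonnegative terms.\<close>

lemma card_partial_injections_le:
  assumes "finite X" "finite Y" "card X \<le> w" "card Y \<le> w"
  shows "card (partial_injections X Y) \<le> u_bound w"
proof -
  have "card (partial_injections X Y)
      \<le> (\<Sum>i=0..card X. (w choose i) * (w choose i) * fact i)"
    unfolding card_partial_injections[OF assms(1,2)]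
    using assms by (intro sum_mono mult_mono binomial_right_mono) auto
  also have "\<dots> \<le> u_bound w"
    unfolding u_bound_def power2_eq_square using assms by (intro sum_mono2) auto
  finally show ?thesis .
qed

section \<open>Orbits of the stabilizer\<close>

text \<open>Removes the inverse hidden in \<open>perm_vec\<close>: a bijection preserves the entries
  of \<open>\<beta>\<close> exactly when its inverse does.\<close>

lemma in_Stab_iff: "\<sigma> \<in> Stab \<beta> \<longleftrightarrow> bij \<sigma> \<and> (\<forall>i. \<beta> $ \<sigma> i = \<beta> $ i)"
  by (auto simp: stabilizer_def BijGroup_def Bij_def perm_vec_def vec_eq_iff bij_inv_eq_iff)
     (metis bij_inv_eq_iff)+

lemma group_action_stab: "group_action (stab_grp \<beta>) UNIV perm_vec"
  for \<beta> :: "real ^ 'n::finite"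
proof -
  interpret group_action "sym_grp :: ('n \<Rightarrow> 'n) monoid" UNIV perm_vec
    by (rule group_action_perm_vec)
  interpret group "sym_grp :: ('n \<Rightarrow> 'n) monoid"
    by (rule group_BijGroup)
  have "group (stab_grp \<beta>)"
    by (rule subgroup_imp_group[OF stabilizer_subgroup]) simp
  moreover have "perm_vec \<in> hom (stab_grp \<beta>) (BijGroup UNIV)"
    using group_hom.homh[OF group_hom] by (auto simp: hom_def stabilizer_def)
  ultimately show ?thesis
    by (simp add: group_action_def group_hom_def group_hom_axioms_def group_BijGroup)
qed

text \<open>The values on \<open>X\<close> form equal multisets and cancel, so the values on the
  complement also agree as multisets. A permutation of the complement matches them and is the
  identity on \<open>X\<close>.\<close>

lemma permutation_extending_agreement:
  fixes g h :: "'n::finite \<Rightarrow> 'b"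
  assumes "image_mset g (mset_set UNIV) = image_mset h (mset_set UNIV)"
    and "\<And>i. i \<in> X \<Longrightarrow> g i = h i"
  obtains p where "p permutes - X" and "\<And>i. g i = h (p i)"
proof -
  have split: "image_mset f (mset_set UNIV) = image_mset f (mset_set X) + image_mset f (mset_set (- X))"
    for f :: "'n \<Rightarrow> 'b"
    using mset_set_Union[of X "- X"] by simp
  have "image_mset g (mset_set X) = image_mset h (mset_set X)"
    using assms(2) by (intro image_mset_cong) simp
  then have "image_mset g (mset_set (- X)) = image_mset h (mset_set (- X))"
    using assms(1) by (simp add: split)
  then obtain p where p: "p permutes - X" "\<forall>i\<in>- X. g i = h (p i)"
    using image_mset_eq_implies_permutes[of "- X" g h] by auto
  moreover have "g i = h (p i)" for i
    using p assms(2) by (cases "i \<in> X") (auto simp: permutes_not_in)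
  ultimately show thesis
    using that by blast
qed

lemma orbit_stab_eqI:
  fixes \<gamma> \<delta> :: "real ^ 'n::finite"
  assumes "image_mset (($) \<gamma>) (mset_set UNIV) = image_mset (($) \<delta>) (mset_set UNIV)"
    and "\<And>i. \<beta> $ i \<noteq> 0 \<Longrightarrow> \<gamma> $ i = \<delta> $ i"
  shows "orbit (stab_grp \<beta>) perm_vec \<gamma> = orbit (stab_grp \<beta>) perm_vec \<delta>"
proof -
  interpret group_action "stab_grp \<beta>" UNIV perm_vec
    by (rule group_action_stab)
  obtain p where p: "p permutes - {i. \<beta> $ i \<noteq> 0}" and eq: "\<And>i. \<gamma> $ i = \<delta> $ p i"
    using permutation_extending_agreement[OF assms(1), of "{i. \<beta> $ i \<noteq> 0}"] assms(2) by auto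
  \<comment> \<open>Either \<open>p\<close> fixes \<open>i\<close>, or both \<open>i\<close> and
    \<open>p i\<close> lie off the support of \<open>\<beta>\<close>, where both entries are
    0.\<close>
  have "\<beta> $ p i = \<beta> $ i" for i
    using permutes_in_image[OF p, of i] permutes_not_in[OF p, of i] by auto
  then have "p \<in> Stab \<beta>"
    using permutes_bij[OF p] by (simp add: in_Stab_iff)
  moreover have "\<delta> = perm_vec p \<gamma>"
    using permutes_inverses[OF p] by (simp add: perm_vec_def vec_eq_iff eq)
  ultimately have "\<delta> \<in> orbit (stab_grp \<beta>) perm_vec \<gamma>"
    by (auto simp: orbit_def)
  then show ?thesis
    by (blast intro: orbit_sym orbit_trans)
qed

text \<open>\<open>F\<close> factors through \<open>key\<close>: its value at \<open>x\<close> can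
  be recovered from \<open>key x\<close> by picking any preimage of that key.\<close>

lemma card_image_le_card_invariant:
  assumes "finite K" "key ` S \<subseteq> K"
    and "\<And>x y. \<lbrakk>x \<in> S; y \<in> S; key x = key y\<rbrakk> \<Longrightarrow> F x = F y"
  shows "card (F ` S) \<le> card K"
proof -
  have "F x = F (inv_into S key (key x))" if "x \<in> S" for x
    using that by (intro assms(3)) (auto intro: inv_into_into f_inv_into_f[symmetric])
  then have "F ` S \<subseteq> (\<lambda>k. F (inv_into S key k)) ` K"
    using assms(2) by blast
  then show ?thesis
    by (meson assms(1) card_image_le card_mono finite_imageI order_trans)
qed

lemma card_stab_orbits_sym_orbit:
  fixes \<alpha> \<beta> :: "real ^ 'n::finite"
  assumes "wt \<alpha> \<le> w" "wt \<beta> \<le> w"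
  shows "card (stab_orbits (sym_orbit \<alpha>) \<beta>) \<le> u_bound w"
proof -
  define X where "X = {i. \<beta> $ i \<noteq> 0}"
  define Y where "Y = {i. \<alpha> $ i \<noteq> 0}"
  \<comment> \<open>The inverse appears because entry \<open>i\<close> of
    \<open>perm_vec \<sigma> \<alpha>\<close> is the entry of \<open>\<alpha>\<close> at the
    preimage of \<open>i\<close>. \<open>D \<sigma>\<close> collects the positions in the support of
    \<open>\<beta>\<close> where this entry is nonzero.\<close>
  define D where "D \<sigma> = {i \<in> X. inv_into UNIV \<sigma> i \<in> Y}" for \<sigma> :: "'n \<Rightarrow> 'n"
  define key where "key \<sigma> = (D \<sigma>, restrict (inv_into UNIV \<sigma>) (D \<sigma>))" for \<sigma>
  let ?F = "\<lambda>\<sigma>. orbit (stab_grp \<beta>) perm_vec (perm_vec \<sigma> \<alpha>)"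
  let ?S = "{\<sigma> :: 'n \<Rightarrow> 'n. bij \<sigma>}"
  have carrier: "carrier (sym_grp :: ('n \<Rightarrow> 'n) monoid) = ?S"
    by (auto simp: BijGroup_def Bij_def)
  have "stab_orbits (sym_orbit \<alpha>) \<beta> = ?F ` ?S"
    by (auto simp: orbits_def orbit_def[of sym_grp] carrier)
  also have "card \<dots> \<le> card (partial_injections X Y)"
  proof (rule card_image_le_card_invariant)
    have "inj_on (inv_into UNIV \<sigma>) Z" if "bij \<sigma>" for \<sigma> :: "'n \<Rightarrow> 'n" and Z
      using bij_is_inj[OF bij_imp_bij_inv[OF that]] by (rule inj_on_subset) simp
    then show "key ` ?S \<subseteq> partial_injections X Y"
      by (auto simp: key_def D_def partial_injections_def split: if_splits)
  next
    fix \<sigma> \<tau> assume "\<sigma> \<in> ?S" "\<tau> \<in> ?S" and key: "key \<sigma> = key \<tau>"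
    then have bij: "bij (inv_into UNIV \<sigma>)" "bij (inv_into UNIV \<tau>)"
      by (simp_all add: bij_imp_bij_inv)
    have mset: "image_mset (($) (perm_vec \<rho> \<alpha>)) (mset_set UNIV) = image_mset (($) \<alpha>) (mset_set UNIV)"
      if "bij (inv_into UNIV \<rho>)" for \<rho>
    proof -
      have "($) (perm_vec \<rho> \<alpha>) = ($) \<alpha> \<circ> inv_into UNIV \<rho>"
        by (rule ext) (simp add: perm_vec_def)
      then have "image_mset (($) (perm_vec \<rho> \<alpha>)) (mset_set UNIV)
          = image_mset (($) \<alpha>) (image_mset (inv_into UNIV \<rho>) (mset_set UNIV))"
        by (simp add: multiset.map_comp)
      also have "image_mset (inv_into UNIV \<rho>) (mset_set UNIV) = mset_set UNIV"
        using that by (simp add: image_mset_mset_set bij_is_inj bij_is_surj)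
      finally show ?thesis .
    qed
    show "?F \<sigma> = ?F \<tau>"
    proof (rule orbit_stab_eqI)
      show "image_mset (($) (perm_vec \<sigma> \<alpha>)) (mset_set UNIV)
          = image_mset (($) (perm_vec \<tau> \<alpha>)) (mset_set UNIV)"
        using mset[OF bij(1)] mset[OF bij(2)] by simp
    next
      fix i assume "\<beta> $ i \<noteq> 0"
      then have i: "i \<in> X"
        by (simp add: X_def)
      have D: "D \<sigma> = D \<tau>" and r: "restrict (inv_into UNIV \<sigma>) (D \<sigma>) = restrict (inv_into UNIV \<tau>) (D \<tau>)"
        using key unfolding key_def prod.inject by blast+
      show "perm_vec \<sigma> \<alpha> $ i = perm_vec \<tau> \<alpha> $ i"
      proof (cases "i \<in> D \<sigma>")
        case True
        then show ?thesis
          using fun_cong[OF r, of i] D by (simp add: perm_vec_def)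
      next
        \<comment> \<open>Outside the common domain both preimages miss the support of
          \<open>\<alpha>\<close>, so both entries are 0.\<close>
        case False
        then have "i \<notin> D \<tau>"
          using D by simp
        with False i show ?thesis
          by (simp add: perm_vec_def D_def Y_def)
      qed
    qed
  qed (simp add: finite_partial_injections)
  also have "\<dots> \<le> u_bound w"
    using assms by (intro card_partial_injections_le) (simp_all add: X_def Y_def wt_def)
  finally show ?thesis .
qed

lemma orbit_reps_cover:
  fixes A :: "(real ^ 'n::finite) set"
  assumes "orbit_reps R A"
  shows "A \<subseteq> (\<Union>r\<in>R. sym_orbit r)"
proof
  interpret group_action "sym_grp :: ('n \<Rightarrow> 'n) monoid" UNIV perm_vec
    by (rule group_action_perm_vec)
  fix a assume "a \<in> A"
  then obtain r where "r \<in> R" "r \<in> sym_orbit a"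
    using assms by (auto simp: orbit_reps_def orbits_def)
  then show "a \<in> (\<Union>r\<in>R. sym_orbit r)"
    using orbit_sym by blast
qed

text \<open>The orbits of the representatives cover \<open>A\<close>, so the bound for a single
  orbit is summed over \<open>R\<close>.\<close>

lemma card_stab_orbits_le:
  fixes A :: "(real ^ 'n::finite) set"
  assumes "orbit_reps R A" "finite A" "\<forall>r\<in>R. wt r \<le> w" "wt \<beta> \<le> w"
  shows "card (stab_orbits A \<beta>) \<le> card R * u_bound w"
proof -
  have "finite R"
    using assms(1,2) by (auto simp: orbit_reps_def intro: finite_subset)
  have fin: "finite (stab_orbits (sym_orbit r) \<beta>)" for r
    by (auto simp: orbits_def orbit_def[of sym_grp] setcompr_eq_image)
  have "stab_orbits A \<beta> \<subseteq> (\<Union>r\<in>R. stab_orbits (sym_orbit r) \<beta>)"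
    using orbit_reps_cover[OF assms(1)] unfolding orbits_def by blast
  then have "card (stab_orbits A \<beta>) \<le> card (\<Union>r\<in>R. stab_orbits (sym_orbit r) \<beta>)"
    using \<open>finite R\<close> fin by (intro card_mono) auto
  also have "\<dots> \<le> (\<Sum>r\<in>R. card (stab_orbits (sym_orbit r) \<beta>))"
    using \<open>finite R\<close> by (rule card_UN_le)
  also have "\<dots> \<le> card R * u_bound w"
    using assms by (intro sum_bounded_above[where K = "u_bound w", simplified] card_stab_orbits_sym_orbit) auto
  finally show ?thesis .
qed

section \<open>Vectors fixed by the stabilizer\<close>

lemma dim_stab_fixed_le:
  fixes \<beta> :: "real ^ 'n::finite"
  shows "dim (stab_fixed \<beta>) \<le> wt \<beta> + 1"
proof -
  define V where "V = range (($) \<beta>)"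
  \<comment> \<open>Indicator vectors of the level sets of \<open>\<beta>\<close>; they span a space
    containing \<open>stab_fixed \<beta>\<close>.\<close>
  define e :: "real \<Rightarrow> real ^ 'n" where "e t = (\<chi> i. if \<beta> $ i = t then 1 else 0)" for t
  \<comment> \<open>The value 0 accounts for the \<open>+ 1\<close>; the other values are taken on
    the support.\<close>
  have "V \<subseteq> insert 0 ((($) \<beta>) ` {i. \<beta> $ i \<noteq> 0})"
    by (auto simp: V_def)
  then have "card V \<le> card (insert 0 ((($) \<beta>) ` {i. \<beta> $ i \<noteq> 0}))"
    by (intro card_mono) auto
  also have "\<dots> \<le> Suc (card ((($) \<beta>) ` {i. \<beta> $ i \<noteq> 0}))"
    by (simp add: card_insert_if)
  also have "\<dots> \<le> wt \<beta> + 1"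
    by (simp add: wt_def card_image_le)
  finally have cardV: "card V \<le> wt \<beta> + 1" .
  have "v \<in> span (e ` V)" if v: "v \<in> stab_fixed \<beta>" for v
  proof -
    have const: "v $ i = v $ j" if "\<beta> $ i = \<beta> $ j" for i j
    proof -
      \<comment> \<open>Swapping two positions of one level set leaves \<open>\<beta>\<close>
        unchanged, hence also \<open>v\<close>.\<close>
      have "Transposition.transpose i j \<in> Stab \<beta>"
        using that by (auto simp: in_Stab_iff Transposition.transpose_def)
      then have "perm_vec (Transposition.transpose i j) v $ i = v $ i"
        using v by (simp add: stab_fixed_def)
      then show ?thesis
        by (simp add: perm_vec_def)
    qed
    define h where "h t = v $ (SOME i. \<beta> $ i = t)" for t
    have h: "h (\<beta> $ i) = v $ i" for i
      unfolding h_def by (rule const) (rule someI, rule refl)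
    have "v = (\<Sum>t\<in>V. h t *\<^sub>R e t)"
    proof (rule vec_eq_iff[THEN iffD2], rule allI)
      fix i
      have "(\<Sum>t\<in>V. h t *\<^sub>R e t) $ i = (\<Sum>t\<in>V. if \<beta> $ i = t then h t else 0)"
        by (simp add: e_def if_distrib cong: if_cong)
      also have "\<dots> = v $ i"
        by (simp add: V_def h)
      finally show "v $ i = (\<Sum>t\<in>V. h t *\<^sub>R e t) $ i" ..
    qed
    also have "\<dots> \<in> span (e ` V)"
      by (intro span_sum span_scale span_base imageI)
    finally show ?thesis .
  qed
  then have "dim (stab_fixed \<beta>) \<le> card (e ` V)"
    by (intro dim_le_card) (auto simp: V_def)
  also have "\<dots> \<le> card V"
    by (rule card_image_le) (simp add: V_def)
  finally show ?thesis
    using cardV by simp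
qed

section \<open>Size of the symmetry-adapted program\<close>

theorem theorem5p3:
  fixes k l w :: nat
    and f c :: "real ^ 'n::finite \<Rightarrow> real"
    and A B Ahat Bhat :: "(real ^ 'n) set"
  assumes "CARD('n) \<ge> 2 * w"
    and "finite A" and "finite B" and "A \<noteq> {}" and "A \<inter> B = {}"
    and "\<forall>\<alpha>\<in>A. c \<alpha> > 0" and "\<forall>\<beta>\<in>B. c \<beta> < 0"
    and "\<forall>x. f x = (\<Sum>\<alpha>\<in>A. c \<alpha> * exp (\<alpha> \<bullet> x)) + (\<Sum>\<beta>\<in>B. c \<beta> * exp (\<beta> \<bullet> x))"
    and "sym_invariant f"
    and "f \<in> C_SAGE A B"
    and "orbit_reps Ahat A" and "orbit_reps Bhat B"
    and "card Ahat \<le> k" and "card Bhat \<le> l"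
    and "Max (wt ` (Ahat \<union> Bhat)) \<le> w"
  shows "num_constraints (sym_program A Ahat Bhat c) \<le> k + l + l * (w + 1) \<and>
         num_variables (sym_program A Ahat Bhat c) \<le> 2 * l * k * u_bound w"
proof
  have fin: "finite Ahat" "finite Bhat"
    using assms by (auto simp: orbit_reps_def intro: finite_subset)
  have wt: "wt \<gamma> \<le> w" if "\<gamma> \<in> Ahat \<union> Bhat" for \<gamma>
  proof -
    have "wt \<gamma> \<le> Max (wt ` (Ahat \<union> Bhat))"
      using that fin by (intro Max_ge) auto
    then show ?thesis
      using assms(15) by (rule order_trans)
  qed
  \<comment> \<open>The balance equations give the summand \<open>l * (w + 1)\<close>; the
    coefficient and entropy inequalities give \<open>k\<close> and \<open>l\<close>.\<close>
  have "(\<Sum>\<beta>\<in>Bhat. dim (stab_fixed \<beta>)) \<le> card Bhat * (w + 1)"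
  proof (rule sum_bounded_above[where K = "w + 1", simplified of_nat_id])
    show "dim (stab_fixed \<beta>) \<le> w + 1" if "\<beta> \<in> Bhat" for \<beta>
      using dim_stab_fixed_le[of \<beta>] wt[of \<beta>] that by simp
  qed
  also have "\<dots> \<le> l * (w + 1)"
    using assms(14) by (rule mult_le_mono1)
  finally show "num_constraints (sym_program A Ahat Bhat c) \<le> k + l + l * (w + 1)"
    unfolding num_constraints_sym_program[OF fin] using assms(13,14) by linarith
  \<comment> \<open>Each orbit carries two variables, \<open>C_var\<close> and
    \<open>Nu_var\<close>, whence the factor 2 in the final bound.\<close>
  have "(\<Sum>\<beta>\<in>Bhat. card (stab_orbits A \<beta>)) \<le> card Bhat * (card Ahat * u_bound w)"
    using assms(2,11) wt
    by (intro sum_bounded_above[where K = "card Ahat * u_bound w", simplified of_nat_id] card_stab_orbits_le) auto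
  also have "\<dots> \<le> l * (k * u_bound w)"
    using assms(13,14) by (intro mult_le_mono) auto
  finally show "num_variables (sym_program A Ahat Bhat c) \<le> 2 * l * k * u_bound w"
    unfolding num_variables_sym_program[OF assms(2) fin(2)] by simp
qed

end
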